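(* Let $x_1,\dots,x_n\in\mathbb{R}^p$, $c\ge 2$, $m_0>1$ and $t\in(0,1)$. Let $\mathcal I\subset(1,\infty)$ be an open interval containing $m_0$, and let $m\mapsto v_j(m)\in\mathbb{R}^p$ ($j=1,\dots,c$) be $C^1$ on $\mathcal I$; in the GK-Mapper case, let in addition $m\mapsto A_j(m)$ ($j=1,\dots,c$) be $C^1$ maps from $\mathcal I$ to symmetric positive definite $p\times p$ real matrices. Let $d_{ij}(m)$ be the SFCM or GK distances, and assume $d_{ij}(m)>0$ for all $i\in\{1,\dots,n\}$, $j\in\{1,\dots,c\}$ and $m\in\mathcal I$ (in particular $d_{ij}(m_0)>0$ for all $i,j$). Let $u_{ij}(m)$ be the corresponding memberships and $G_t(m)$ the corresponding (SFCM or GK-Mapper) graph. Suppose $$u_{ij}(m_0)\neq t\qquad\text{for all } i\in\{1,\dots,n\},\ j\in\{1,\dots,c\}.$$ Then there exists $r^*>0$ such that $G_t(m)=G_t(m_0)$ whenever $|m-m_0|<r^*$ (with $(m_0-r^*,m_0+r^* )\subset\mathcal I$). Hence both the SFCM graph and the GK-Mapper graph are locally constant with respect to the fuzzifier $m$ near every such non-threshold value $m_0$.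
   Context: Distances: in the SFCM case $d_{ij}(m)=\|x_i-v_j(m)\|$ (Euclidean norm); in the GK-Mapper case $d_{ij}(m)=\sqrt{(x_i-v_j(m))^\top A_j(m)(x_i-v_j(m))}$. Memberships: $u_{ij}(m)=\left[\sum_{k=1}^{c}\left(d_{ij}(m)/d_{ik}(m)\right)^{2/(m-1)}\right]^{-1}$. Graph: for a threshold $t$, let $C_j(t,m)=\{x_i: u_{ij}(m)\ge t\}$, where data points are identified by their index $i$. The graph $G_t(m)$ has vertex set $\{1,\dots,c\}$ and, for $j\ne k$, an (undirected) edge $(j,k)$ if and only if $C_j(t,m)\cap C_k(t,m)\ne\emptyset$. It is called the SFCM graph or the GK-Mapper graph according to which distance is used. Two such graphs are equal when they have the same edge set. *)

theory Defs
  imports "HOL-Analysis.Analysis"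
begin

definition sym_pos_def :: "real ^ 'p ^ 'p \<Rightarrow> bool" where
  "sym_pos_def A \<longleftrightarrow> transpose A = A \<and> (\<forall>y. y \<noteq> 0 \<longrightarrow> y \<bullet> (A *v y) > 0)"

text \<open>
  Data points \<open>x i\<close> are indexed by \<open>i \<in> {1..n}\<close> and clusters by \<open>j \<in> {1..c}\<close>.
  The centers \<open>v j\<close> and the norm-inducing matrices \<open>A j\<close> are functions of the fuzzifier \<open>m\<close>.
\<close>

definition sfcm_dist ::
  "(nat \<Rightarrow> real ^ 'p) \<Rightarrow> (nat \<Rightarrow> real \<Rightarrow> real ^ 'p) \<Rightarrow> real \<Rightarrow> nat \<Rightarrow> nat \<Rightarrow> real" where
  "sfcm_dist x v m i j = norm (x i - v j m)"

definition gk_dist ::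
  "(nat \<Rightarrow> real ^ 'p) \<Rightarrow> (nat \<Rightarrow> real \<Rightarrow> real ^ 'p) \<Rightarrow> (nat \<Rightarrow> real \<Rightarrow> real ^ 'p ^ 'p) \<Rightarrow>
    real \<Rightarrow> nat \<Rightarrow> nat \<Rightarrow> real" where
  "gk_dist x v A m i j = sqrt ((x i - v j m) \<bullet> (A j m *v (x i - v j m)))"

definition membership ::
  "nat \<Rightarrow> (real \<Rightarrow> nat \<Rightarrow> nat \<Rightarrow> real) \<Rightarrow> real \<Rightarrow> nat \<Rightarrow> nat \<Rightarrow> real" where
  "membership c d m i j = inverse (\<Sum>k=1..c. (d m i j / d m i k) powr (2 / (m - 1)))"

definition fuzzy_cluster ::
  "nat \<Rightarrow> nat \<Rightarrow> (real \<Rightarrow> nat \<Rightarrow> nat \<Rightarrow> real) \<Rightarrow> real \<Rightarrow> real \<Rightarrow> nat \<Rightarrow> nat set" where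
  "fuzzy_cluster n c d t m j = {i \<in> {1..n}. membership c d m i j \<ge> t}"

text \<open>
  A graph is the pair of its vertex set and its set of undirected edges \<open>{j, k}\<close>. All graphs
  built from the same \<open>c\<close> share their vertex set, so equality of such pairs is equality of the
  edge sets.
\<close>

definition mapper_graph ::
  "nat \<Rightarrow> nat \<Rightarrow> (real \<Rightarrow> nat \<Rightarrow> nat \<Rightarrow> real) \<Rightarrow> real \<Rightarrow> real \<Rightarrow> nat set \<times> nat set set" where
  "mapper_graph n c d t m =
    ({1..c},
     {{j, k} | j k. j \<in> {1..c} \<and> k \<in> {1..c} \<and> j \<noteq> k \<and>
        fuzzy_cluster n c d t m j \<inter> fuzzy_cluster n c d t m k \<noteq> {}})"

definition sfcm_graph ::
  "nat \<Rightarrow> nat \<Rightarrow> (nat \<Rightarrow> real ^ 'p) \<Rightarrow> (nat \<Rightarrow> real \<Rightarrow> real ^ 'p) \<Rightarrow> real \<Rightarrow> real \<Rightarrow>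
    nat set \<times> nat set set" where
  "sfcm_graph n c x v t m = mapper_graph n c (sfcm_dist x v) t m"

definition gk_mapper_graph ::
  "nat \<Rightarrow> nat \<Rightarrow> (nat \<Rightarrow> real ^ 'p) \<Rightarrow> (nat \<Rightarrow> real \<Rightarrow> real ^ 'p) \<Rightarrow>
    (nat \<Rightarrow> real \<Rightarrow> real ^ 'p ^ 'p) \<Rightarrow> real \<Rightarrow> real \<Rightarrow> nat set \<times> nat set set" where
  "gk_mapper_graph n c x v A t m = mapper_graph n c (gk_dist x v A) t m"

end

theory Submission
  imports Defs
begin

text \<open>The graph depends on \<open>m\<close> only through the finitely many truth values of
  \<open>t \<le> membership c d m i j\<close>. Each membership is continuous at \<open>m0\<close>:
  the distances are continuous and positive there, and the exponent \<open>2 / (m - 1)\<close> is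
  continuous because \<open>m0 > 1\<close> (\<open>isCont_membership\<close>). A continuous function
  whose value at \<open>m0\<close> differs from \<open>t\<close> stays on the same side of
  \<open>t\<close> nearby (\<open>eventually_ge_iff_of_isCont\<close>). Intersecting finitely many
  neighbourhoods freezes all clusters, hence all edges. \<open>mapper_graph_locally_constant\<close>
  carries this out for an abstract distance \<open>d\<close>, so SFCM and GK-Mapper differ only in
  the proof that their distances are continuous.\<close>

lemma C1_differentiable_on_imp_isCont:
  assumes "f C1_differentiable_on S" and "m \<in> S"
  shows "isCont f m"
  using assms unfolding C1_differentiable_on_def
  by (blast intro: has_vector_derivative_continuous)

lemma tendsto_matrix_vector_mult:
  fixes A :: "'a \<Rightarrow> real ^ 'n ^ 'm"
  assumes "(A \<longlongrightarrow> B) F" and "(y \<longlongrightarrow> z) F"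
  shows "((\<lambda>s. A s *v y s) \<longlongrightarrow> B *v z) F"
  unfolding matrix_vector_mult_def by (intro tendsto_intros assms)

text \<open>Positivity at \<open>m0\<close> keeps every operation in the formula away from its
  singularity: the quotients, the powers with varying exponent, and the outer inverse.\<close>

lemma isCont_membership:
  assumes "m0 > 1" and "j \<in> {1..c}"
    and cont: "\<And>k. k \<in> {1..c} \<Longrightarrow> isCont (\<lambda>m. d m i k) m0"
    and pos: "\<And>k. k \<in> {1..c} \<Longrightarrow> d m0 i k > 0"
  shows "isCont (\<lambda>m. membership c d m i j) m0"
proof -
  have ratio_pos: "d m0 i j / d m0 i k > 0" if "k \<in> {1..c}" for k
    using pos[OF that] pos[OF assms(2)] by simp
  \<comment> \<open>The limit of the sum must be nonzero for \<open>tendsto_inverse\<close>.\<close>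
  have "(\<Sum>k=1..c. (d m0 i j / d m0 i k) powr (2 / (m0 - 1))) > 0"
  proof (rule sum_pos)
    show "{1..c} \<noteq> {}"
      using assms(2) by blast
    show "(d m0 i j / d m0 i k) powr (2 / (m0 - 1)) > 0" if "k \<in> {1..c}" for k
      using ratio_pos[OF that] by (metis less_irrefl powr_gt_zero)
  qed simp
  moreover have "isCont (\<lambda>m. (d m i j / d m i k) powr (2 / (m - 1))) m0" if "k \<in> {1..c}" for k
  proof -
    \<comment> \<open>These are the side conditions of the limit rules: nonzero denominators of the
      ratio and of the exponent, and a nonzero base for \<open>tendsto_powr\<close>.\<close>
    have "d m0 i k \<noteq> 0" "d m0 i j / d m0 i k \<noteq> 0" "m0 - 1 \<noteq> 0"
      using pos[OF that] ratio_pos[OF that] assms(1) by auto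
    then show ?thesis
      using cont[OF that] cont[OF assms(2)] unfolding isCont_def
      by (intro tendsto_powr tendsto_divide tendsto_diff tendsto_const tendsto_ident_at)
  qed
  ultimately show ?thesis
    unfolding membership_def isCont_def
    by (intro tendsto_inverse tendsto_sum) auto
qed

text \<open>Both open rays bounded by \<open>t\<close> are open sets, and \<open>f a\<close> lies in
  one of them.\<close>

lemma eventually_ge_iff_of_isCont:
  fixes f :: "'a::t2_space \<Rightarrow> 'b::linorder_topology"
  assumes "isCont f a" and "f a \<noteq> t"
  shows "\<forall>\<^sub>F s in nhds a. t \<le> f s \<longleftrightarrow> t \<le> f a"
proof -
  \<comment> \<open>Passing from the punctured filter to \<open>nhds a\<close> gives a full
    neighbourhood, centre included.\<close>
  have lim: "(f \<longlongrightarrow> f a) (nhds a)"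
    using assms(1) by (simp add: isCont_def tendsto_at_iff_tendsto_nhds)
  show ?thesis
  proof (cases "t < f a")
    case True
    from order_tendstoD(1)[OF lim this] show ?thesis
      by eventually_elim (use True in auto)
  next
    case False
    with assms(2) have "f a < t"
      by auto
    from order_tendstoD(2)[OF lim this] show ?thesis
      by eventually_elim (use \<open>f a < t\<close> in auto)
  qed
qed

text \<open>The common core of both cases: \<open>d\<close> enters only through continuity and
  positivity at \<open>m0\<close>.\<close>

lemma mapper_graph_locally_constant:
  assumes "m0 > 1" and "open S" and "m0 \<in> S"
    and cont: "\<And>i j. i \<in> {1..n} \<Longrightarrow> j \<in> {1..c} \<Longrightarrow> isCont (\<lambda>m. d m i j) m0"
    and pos: "\<And>i j. i \<in> {1..n} \<Longrightarrow> j \<in> {1..c} \<Longrightarrow> d m0 i j > 0"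
    and ne: "\<And>i j. i \<in> {1..n} \<Longrightarrow> j \<in> {1..c} \<Longrightarrow> membership c d m0 i j \<noteq> t"
  shows "\<exists>r>0. {m0 - r<..<m0 + r} \<subseteq> S \<and>
    (\<forall>m. \<bar>m - m0\<bar> < r \<longrightarrow> mapper_graph n c d t m = mapper_graph n c d t m0)"
proof -
  have "\<forall>\<^sub>F m in nhds m0. t \<le> membership c d m i j \<longleftrightarrow> t \<le> membership c d m0 i j"
    if "i \<in> {1..n}" "j \<in> {1..c}" for i j
    by (intro eventually_ge_iff_of_isCont isCont_membership assms that)
  \<comment> \<open>Finiteness of both index ranges permits moving the quantifiers inside the
    filter; \<open>m \<in> S\<close> is added so that one radius serves both conclusions.\<close>
  then have "\<forall>\<^sub>F m in nhds m0. m \<in> S \<and> (\<forall>i\<in>{1..n}. \<forall>j\<in>{1..c}.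
      t \<le> membership c d m i j \<longleftrightarrow> t \<le> membership c d m0 i j)"
    by (intro eventually_conj eventually_nhds_in_open assms eventually_ball_finite ballI
        finite_atLeastAtMost)
  then obtain r where "r > 0" and r: "\<And>m. \<bar>m - m0\<bar> < r \<Longrightarrow> m \<in> S"
    "\<And>m i j. \<bar>m - m0\<bar> < r \<Longrightarrow> i \<in> {1..n} \<Longrightarrow> j \<in> {1..c} \<Longrightarrow>
      t \<le> membership c d m i j \<longleftrightarrow> t \<le> membership c d m0 i j"
    unfolding eventually_nhds_metric dist_real_def by blast
  have "mapper_graph n c d t m = mapper_graph n c d t m0" if "\<bar>m - m0\<bar> < r" for m
  proof -
    have "fuzzy_cluster n c d t m j = fuzzy_cluster n c d t m0 j" if "j \<in> {1..c}" for j
      using r(2)[OF \<open>\<bar>m - m0\<bar> < r\<close> _ that] unfolding fuzzy_cluster_def by blast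
    \<comment> \<open>Edges involve only clusters with index in \<open>{1..c}\<close>, and on these
      the clusters at \<open>m\<close> and \<open>m0\<close> coincide.\<close>
    then show ?thesis
      unfolding mapper_graph_def by (metis (no_types, lifting))
  qed
  moreover have "{m0 - r<..<m0 + r} \<subseteq> S"
    by (auto intro!: r(1))
  ultimately show ?thesis
    using \<open>r > 0\<close> by blast
qed

theorem theorem2:
  fixes n c :: nat
    and x :: "nat \<Rightarrow> real ^ 'p"
    and v :: "nat \<Rightarrow> real \<Rightarrow> real ^ 'p"
    and m0 t :: real
    and I :: "real set"
  assumes "c \<ge> 2" and "m0 > 1" and "0 < t" and "t < 1"
    and "open I" and "is_interval I" and "I \<subseteq> {1<..}" and "m0 \<in> I"
    and "\<forall>j\<in>{1..c}. v j C1_differentiable_on I"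
  shows
    "((\<forall>i\<in>{1..n}. \<forall>j\<in>{1..c}. \<forall>m\<in>I. sfcm_dist x v m i j > 0) \<and>
      (\<forall>i\<in>{1..n}. \<forall>j\<in>{1..c}. membership c (sfcm_dist x v) m0 i j \<noteq> t)
      \<longrightarrow> (\<exists>r>0. {m0 - r<..<m0 + r} \<subseteq> I \<and>
            (\<forall>m. \<bar>m - m0\<bar> < r \<longrightarrow> sfcm_graph n c x v t m = sfcm_graph n c x v t m0)))
     \<and>
     (\<forall>A :: nat \<Rightarrow> real \<Rightarrow> real ^ 'p ^ 'p.
      (\<forall>j\<in>{1..c}. A j C1_differentiable_on I) \<and>
      (\<forall>j\<in>{1..c}. \<forall>m\<in>I. sym_pos_def (A j m)) \<and>
      (\<forall>i\<in>{1..n}. \<forall>j\<in>{1..c}. \<forall>m\<in>I. gk_dist x v A m i j > 0) \<and>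
      (\<forall>i\<in>{1..n}. \<forall>j\<in>{1..c}. membership c (gk_dist x v A) m0 i j \<noteq> t)
      \<longrightarrow> (\<exists>r>0. {m0 - r<..<m0 + r} \<subseteq> I \<and>
            (\<forall>m. \<bar>m - m0\<bar> < r \<longrightarrow> gk_mapper_graph n c x v A t m = gk_mapper_graph n c x v A t m0)))"
proof -
  have cont_v: "isCont (v j) m0" if "j \<in> {1..c}" for j
    using C1_differentiable_on_imp_isCont assms(8,9) that by blast
  have "\<exists>r>0. {m0 - r<..<m0 + r} \<subseteq> I \<and>
      (\<forall>m. \<bar>m - m0\<bar> < r \<longrightarrow> sfcm_graph n c x v t m = sfcm_graph n c x v t m0)"
    if "\<forall>i\<in>{1..n}. \<forall>j\<in>{1..c}. \<forall>m\<in>I. sfcm_dist x v m i j > 0"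
      and "\<forall>i\<in>{1..n}. \<forall>j\<in>{1..c}. membership c (sfcm_dist x v) m0 i j \<noteq> t"
  proof -
    have "isCont (\<lambda>m. sfcm_dist x v m i j) m0" if "j \<in> {1..c}" for i j
      using cont_v[OF that] unfolding sfcm_dist_def by (intro continuous_intros)
    then show ?thesis
      unfolding sfcm_graph_def
      by (intro mapper_graph_locally_constant assms) (use that assms(8) in blast)+
  qed
  moreover have "\<exists>r>0. {m0 - r<..<m0 + r} \<subseteq> I \<and>
      (\<forall>m. \<bar>m - m0\<bar> < r \<longrightarrow> gk_mapper_graph n c x v A t m = gk_mapper_graph n c x v A t m0)"
    if "\<forall>j\<in>{1..c}. A j C1_differentiable_on I"
      and "\<forall>i\<in>{1..n}. \<forall>j\<in>{1..c}. \<forall>m\<in>I. gk_dist x v A m i j > 0"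
      and "\<forall>i\<in>{1..n}. \<forall>j\<in>{1..c}. membership c (gk_dist x v A) m0 i j \<noteq> t"
    for A :: "nat \<Rightarrow> real \<Rightarrow> real ^ 'p ^ 'p"
  proof -
    have "isCont (A j) m0" if "j \<in> {1..c}" for j
      using C1_differentiable_on_imp_isCont assms(8) \<open>\<forall>j\<in>{1..c}. A j C1_differentiable_on I\<close> that
      by blast
    \<comment> \<open>The quadratic form is built from \<open>A j\<close> and \<open>v j\<close> by
      matrix-vector and inner products, which preserve limits, as does the square root.\<close>
    then have "isCont (\<lambda>m. gk_dist x v A m i j) m0" if "j \<in> {1..c}" for i j
      using cont_v that unfolding gk_dist_def isCont_def
      by (intro tendsto_intros tendsto_matrix_vector_mult) auto
    then show ?thesis
      unfolding gk_mapper_graph_def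
      by (intro mapper_graph_locally_constant assms) (use that assms(8) in blast)+
  qed
  ultimately show ?thesis
    by blast
qed

end
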